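(* Every $11$-cap of dimension $7$ in $\mathbb{Z}_2^n$ has a basis of type $5\text{-}5\text{-}5$.
   Context: Work in $\mathbb{Z}_2^n$. An affine combination of a set is a sum of an odd number of its distinct elements; $\operatorname{aff}(S)$ is the set of all affine combinations of elements of $S$, and the dimension of $S$ is the dimension of the affine flat $\operatorname{aff}(S)$. A basis for $S$ is a subset $B\subseteq S$ that is affinely independent (no element is an affine combination of the others) with $\operatorname{aff}(B)=\operatorname{aff}(S)$; its dependent set is $D=S\setminus B$. For $x\in D$, $B_x$ is the unique subset of $B$ whose elements sum to $x$. A quad is a set of four distinct elements summing to $\mathbf{0}$; a cap is a quad-free subset; a $k$-cap is a cap with $k$ elements. The type of $B$ is the list of the numbers $|B_x|$, $x\in D$, in nonincreasing order, separated by hyphens. *)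

theory Defs
  imports "HOL-Analysis.Cartesian_Space" "HOL-Library.Z2" "HOL-Library.Multiset"
begin

text \<open>The space \<open>\<int>\<^sub>2\<^sup>n\<close> is \<open>bit ^ 'n\<close>, where \<open>n = CARD('n)\<close>.\<close>

text \<open>An infinite \<open>T\<close> has \<open>card T = 0\<close>, so \<open>odd (card T)\<close> already forces \<open>T\<close> to be finite.\<close>

definition aff :: "(bit ^ 'n) set \<Rightarrow> (bit ^ 'n) set" where
  "aff S = {\<Sum>T | T. T \<subseteq> S \<and> odd (card T)}"

text \<open>The dimension of a nonempty flat is the linear dimension of its direction space.
  (The empty set gets dimension 0.)\<close>

definition flat_dim :: "(bit ^ 'n) set \<Rightarrow> nat" where
  "flat_dim F = vec.dim {x - y | x y. x \<in> F \<and> y \<in> F}"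

definition affine_dim :: "(bit ^ 'n) set \<Rightarrow> nat" where
  "affine_dim S = flat_dim (aff S)"

definition affine_indep :: "(bit ^ 'n) set \<Rightarrow> bool" where
  "affine_indep B \<longleftrightarrow> (\<forall>x\<in>B. x \<notin> aff (B - {x}))"

definition affine_basis :: "(bit ^ 'n) set \<Rightarrow> (bit ^ 'n) set \<Rightarrow> bool" where
  "affine_basis B S \<longleftrightarrow> B \<subseteq> S \<and> affine_indep B \<and> aff B = aff S"

text \<open>The set \<open>B\<^sub>x\<close>.  The representation of \<open>x\<close> is as an affine combination, so the number of
  summands is odd; without this requirement uniqueness fails as soon as \<open>0 \<in> aff B\<close>.\<close>

definition basis_rep :: "(bit ^ 'n) set \<Rightarrow> bit ^ 'n \<Rightarrow> (bit ^ 'n) set" where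
  "basis_rep B x = (THE T. T \<subseteq> B \<and> odd (card T) \<and> \<Sum>T = x)"

definition quad :: "(bit ^ 'n) set \<Rightarrow> bool" where
  "quad Q \<longleftrightarrow> card Q = 4 \<and> \<Sum>Q = 0"

definition cap :: "(bit ^ 'n) set \<Rightarrow> bool" where
  "cap S \<longleftrightarrow> \<not> (\<exists>Q\<subseteq>S. quad Q)"

definition k_cap :: "nat \<Rightarrow> (bit ^ 'n) set \<Rightarrow> bool" where
  "k_cap k S \<longleftrightarrow> cap S \<and> finite S \<and> card S = k"

definition basis_type :: "(bit ^ 'n) set \<Rightarrow> (bit ^ 'n) set \<Rightarrow> nat list" where
  "basis_type S B =
    rev (sorted_list_of_multiset (image_mset (\<lambda>x. card (basis_rep B x)) (mset_set (S - B))))"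

end

theory Submission imports Defs
begin

text \<open>Identify a dependency of \<open>S\<close> with an even subset of sum \<open>0\<close>. The dependencies of an
  \<open>11\<close>-cap of dimension \<open>7\<close> form a binary code of length \<open>11\<close> and dimension \<open>3\<close> with even
  weights, and quad-freeness says that the minimum weight is at least \<open>6\<close>. The seven nonzero
  weights add up to at most \<open>4 \<cdot> 11 = 44\<close>, and to a multiple of \<open>4\<close>, so six of them are \<open>6\<close> and
  one is \<open>8\<close>; this determines the sizes of all regions of the Venn diagram of three
  generators, and none of the seven inner regions is empty. Hence any three
  independent words of weight \<open>6\<close> have private points, and deleting one private point of
  each leaves a basis of type \<open>5-5-5\<close>.\<close>

section \<open>Arithmetic in characteristic 2 and symmetric differences\<close>

lemma bit_vec_add_self [simp]: "x + x = (0 :: bit ^ 'n)"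
  by (simp add: vec_eq_iff)

lemma bit_vec_add_self_left [simp]: "x + (x + y) = (y :: bit ^ 'n)"
  by (metis add.assoc add.left_neutral bit_vec_add_self)

lemma bit_vec_diff: "x - y = x + (y :: bit ^ 'n)"
  by (simp add: vec_eq_iff)

lemma bit_vec_add_eq_0_iff: "x + y = (0 :: bit ^ 'n) \<longleftrightarrow> x = y"
  by (metis add.assoc add.left_neutral add.right_neutral bit_vec_add_self)

text \<open>The summands in \<open>A \<inter> B\<close> occur twice on the right and cancel.
  Together with the parity count below, this makes symmetric difference the addition of code
  words.\<close>

lemma sum_sym_diff_bit_vec:
  fixes A B :: "(bit ^ 'n) set"
  assumes "finite A" "finite B"
  shows "\<Sum>(sym_diff A B) = \<Sum>A + \<Sum>B"
proof -
  have "\<Sum>(sym_diff A B) = \<Sum>(A - B) + \<Sum>(B - A)"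
    using assms by (intro sum.union_disjoint) auto
  moreover have "\<Sum>A = \<Sum>(A - B) + \<Sum>(A \<inter> B)"
    using assms by (metis Diff_disjoint Int_Diff_Un Int_Diff_disjoint add.commute finite_Diff
        finite_Int sum.union_disjoint)
  moreover have "\<Sum>B = \<Sum>(B - A) + \<Sum>(A \<inter> B)"
    using assms by (metis Int_commute Int_Diff_Un Int_Diff_disjoint add.commute finite_Diff
        finite_Int sum.union_disjoint)
  ultimately show ?thesis by (simp add: add_ac)
qed

lemma even_card_sym_diff:
  assumes "finite A" "finite B"
  shows "even (card (sym_diff A B)) \<longleftrightarrow> even (card A + card B)"
proof -
  have "card (sym_diff A B) = card (A - B) + card (B - A)"
    using assms by (intro card_Un_disjoint) auto
  moreover have "card A = card (A - B) + card (A \<inter> B)"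
    using assms by (metis Int_Diff_Un Int_Diff_disjoint add.commute finite_Diff finite_Int
        card_Un_disjoint)
  moreover have "card B = card (B - A) + card (A \<inter> B)"
    using assms by (metis Int_commute Int_Diff_Un Int_Diff_disjoint add.commute finite_Diff
        finite_Int card_Un_disjoint)
  ultimately show ?thesis by auto
qed

section \<open>Affine combinations\<close>

lemma finite_if_odd_card: "odd (card T) \<Longrightarrow> finite T"
  by (metis card.infinite even_zero)

lemma affI: "T \<subseteq> S \<Longrightarrow> odd (card T) \<Longrightarrow> \<Sum>T = x \<Longrightarrow> x \<in> aff S"
  unfolding aff_def by auto

lemma aff_empty [simp]: "aff {} = {}"
  by (auto simp: aff_def)

lemma subset_aff: "S \<subseteq> aff S"
proof
  fix x assume "x \<in> S"
  then show "x \<in> aff S" by (intro affI[of "{x}"]) auto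
qed

lemma aff_mono: "A \<subseteq> B \<Longrightarrow> aff A \<subseteq> aff B"
  unfolding aff_def by blast

text \<open>Symmetric difference drops repeated summands, which cancel, and keeps the parity of the
  total count. So three odd sets combine to an odd set of distinct points.\<close>

lemma aff_add3:
  assumes "x \<in> aff S" "y \<in> aff S" "z \<in> aff S"
  shows "x + y + z \<in> aff S"
proof -
  obtain T U V where *: "T \<subseteq> S" "odd (card T)" "\<Sum>T = x" "U \<subseteq> S" "odd (card U)" "\<Sum>U = y"
      "V \<subseteq> S" "odd (card V)" "\<Sum>V = z"
    using assms unfolding aff_def by blast
  define X where "X = sym_diff T U"
  have fin: "finite T" "finite U" "finite V" using * by (auto intro: finite_if_odd_card)
  have X: "X \<subseteq> S" "even (card X)" "\<Sum>X = x + y" "finite X"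
    using * fin by (auto simp: X_def even_card_sym_diff sum_sym_diff_bit_vec)
  have "sym_diff X V \<subseteq> S" "odd (card (sym_diff X V))" "\<Sum>(sym_diff X V) = x + y + z"
    using * X fin by (auto simp: even_card_sym_diff sum_sym_diff_bit_vec)
  then show ?thesis by (rule affI)
qed

section \<open>Affine hulls and dimension through linear spans\<close>

text \<open>Translation by a point of \<open>S\<close> sends that point to 0 and the hull to a
  linear subspace, so linear algebra applies. As \<open>(+) s\<close> is an involution, it also
  translates back.\<close>

lemma aff_eq_translate_span:
  fixes S :: "(bit ^ 'n) set"
  assumes s: "s \<in> S"
  shows "aff S = (+) s ` vec.span ((+) s ` S)"
proof
  show "aff S \<subseteq> (+) s ` vec.span ((+) s ` S)"
  proof
    fix x assume "x \<in> aff S"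
    then obtain T where T: "T \<subseteq> S" "odd (card T)" "\<Sum>T = x" unfolding aff_def by blast
    have fin: "finite T" using T by (simp add: finite_if_odd_card)
    \<comment> \<open>Only the parity of the number of copies of \<open>s\<close> counts, so an odd
      sum of translates is the translate of the sum. Rewriting by \<open>sum_constant\<close> would
      hide this parity in a product with \<open>card A\<close>.\<close>
    have const: "(\<Sum>t\<in>A. s) = (if odd (card A) then s else 0)" if "finite A" for A :: "(bit ^ 'n) set"
      using that by (induction rule: finite_induct) (simp_all del: sum_constant)
    have "(\<Sum>t\<in>T. s + t) = s + x"
      using T const[OF fin] by (simp add: sum.distrib del: sum_constant)
    moreover have "(\<Sum>t\<in>T. s + t) \<in> vec.span ((+) s ` S)"
      using T by (intro vec.span_sum vec.span_base) auto
    ultimately show "x \<in> (+) s ` vec.span ((+) s ` S)"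
      by (metis bit_vec_add_self_left imageI)
  qed
next
  have "s + v \<in> aff S" if "v \<in> vec.span ((+) s ` S)" for v
    using that
  proof (induction rule: vec.span_induct_alt)
    case base
    then show ?case using s subset_aff[of S] by auto
  next
    case (step c x y)
    then obtain t where t: "t \<in> S" "x = s + t" by blast
    \<comment> \<open>Two of the three copies of \<open>s\<close> cancel; the right side is a sum of
      three points of the hull, the last by induction.\<close>
    have "s + (x + y) = s + t + (s + y)"
      using t by (simp add: add_ac)
    moreover have "s \<in> aff S" "t \<in> aff S" using s t subset_aff by auto
    ultimately have "s + (x + y) \<in> aff S" using aff_add3[OF _ _ step.IH] by metis
    then show ?case using step by (cases c) auto
  qed
  then show "(+) s ` vec.span ((+) s ` S) \<subseteq> aff S" by blast
qed

lemma affine_dim_eq_dim_translate: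
  fixes S :: "(bit ^ 'n) set"
  assumes s: "s \<in> S"
  shows "affine_dim S = vec.dim ((+) s ` S)"
proof -
  let ?V = "vec.span ((+) s ` S)"
  have "{x - y | x y. x \<in> aff S \<and> y \<in> aff S} = ?V"
  proof
    have "s + u + (s + v) = u + v" for u v :: "bit ^ 'n"
      by (simp add: add_ac)
    then show "{x - y | x y. x \<in> aff S \<and> y \<in> aff S} \<subseteq> ?V"
      by (auto simp: bit_vec_diff aff_eq_translate_span[OF s] intro: vec.span_add)
    have "v = (s + v) - (s + 0)" for v :: "bit ^ 'n"
      by simp
    then show "?V \<subseteq> {x - y | x y. x \<in> aff S \<and> y \<in> aff S}"
      unfolding aff_eq_translate_span[OF s] using vec.span_zero by blast
  qed
  then show ?thesis
    unfolding affine_dim_def flat_dim_def by (simp add: vec.dim_span)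
qed

text \<open>The base point \<open>s\<close> translates to 0 and adds nothing to the span, so
  \<open>card S - 1\<close> vectors suffice.\<close>

lemma affine_dim_less_card:
  fixes S :: "(bit ^ 'n) set"
  assumes "finite S" "s \<in> S"
  shows "affine_dim S < card S"
proof -
  have "vec.span ((+) s ` S) \<subseteq> vec.span ((+) s ` (S - {s}))"
  proof (intro vec.span_minimal vec.subspace_span subsetI)
    fix v assume "v \<in> (+) s ` S"
    then obtain t where t: "t \<in> S" "v = s + t" by blast
    show "v \<in> vec.span ((+) s ` (S - {s}))"
    proof (cases "t = s")
      case True
      then show ?thesis using t by (simp add: vec.span_zero)
    next
      case False
      then show ?thesis using t by (intro vec.span_base) blast
    qed
  qed
  then have "vec.dim ((+) s ` S) \<le> card ((+) s ` (S - {s}))"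
    using assms(1) vec.span_superset by (intro vec.dim_le_card) (blast, simp)
  also have "\<dots> \<le> card (S - {s})" using assms by (intro card_image_le) auto
  also have "\<dots> < card S" using assms by (intro psubset_card_mono) auto
  finally show ?thesis using affine_dim_eq_dim_translate[OF assms(2)] by simp
qed

lemma aff_eq_if_between:
  fixes S :: "(bit ^ 'n) set"
  assumes "B \<subseteq> S" "S \<subseteq> aff B"
  shows "aff B = aff S"
\<comment> \<open>An empty \<open>B\<close> offers no base point, but then
  \<open>S \<subseteq> aff {} = {}\<close>.\<close>
proof (cases "B = {}")
  case True
  then show ?thesis using assms by auto
next
  case False
  then obtain s where s: "s \<in> B" by blast
  have "(+) s ` S \<subseteq> vec.span ((+) s ` B)"
    using assms(2) unfolding aff_eq_translate_span[OF s] by auto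
  then have "vec.span ((+) s ` S) \<subseteq> vec.span ((+) s ` B)"
    by (intro vec.span_minimal vec.subspace_span)
  then have "aff S \<subseteq> aff B"
    using s assms(1) by (simp add: aff_eq_translate_span[OF s] aff_eq_translate_span[of s S] subsetD image_mono)
  then show ?thesis using aff_mono[OF assms(1)] by blast
qed

text \<open>Take a linear basis of the translate of \<open>S\<close>, add 0 for the base point, and
  translate back. The added 0 accounts for \<open>Suc\<close>.\<close>

lemma affine_spanning_subset_exists:
  fixes S :: "(bit ^ 'n) set"
  assumes "finite S" "S \<noteq> {}"
  obtains B where "B \<subseteq> S" "card B = Suc (affine_dim S)" "S \<subseteq> aff B"
proof -
  obtain s where s: "s \<in> S" using assms by blast
  obtain V where V: "V \<subseteq> (+) s ` S" "vec.independent V" "(+) s ` S \<subseteq> vec.span V"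
      "card V = vec.dim ((+) s ` S)"
    using vec.basis_exists by blast
  have finV: "finite V" using V(1) assms finite_surj by blast
  have 0: "0 \<notin> V" using V(2) vec.dependent_zero by blast
  let ?B = "(+) s ` insert 0 V"
  have "?B \<subseteq> S" using V(1) s by auto
  moreover have "card ?B = Suc (affine_dim S)"
    using finV 0 V(4) affine_dim_eq_dim_translate[OF s] by (subst card_image) auto
  moreover have "S \<subseteq> aff ?B"
  proof
    fix x assume "x \<in> S"
    have "s \<in> ?B" by (simp add: image_iff)
    then have "aff ?B = (+) s ` vec.span ((+) s ` ?B)" by (rule aff_eq_translate_span)
    also have "(+) s ` ?B = insert 0 V" by (simp add: image_image)
    finally have "aff ?B = (+) s ` vec.span V" by (simp add: vec.span_insert_0)
    moreover have "s + x \<in> vec.span V" using V(3) \<open>x \<in> S\<close> by blast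
    ultimately show "x \<in> aff ?B" by (metis bit_vec_add_self_left imageI)
  qed
  ultimately show thesis by (rule that)
qed

section \<open>Affine independence and unique representations\<close>

text \<open>Removing a redundant point would keep the dimension but leave too few points for
  \<open>affine_dim_less_card\<close>.\<close>

lemma affine_indep_if_card_le:
  fixes B :: "(bit ^ 'n) set"
  assumes "finite B" "card B \<le> Suc (affine_dim B)"
  shows "affine_indep B"
  unfolding affine_indep_def
proof (intro ballI notI)
  fix x assume x: "x \<in> B" "x \<in> aff (B - {x})"
  then have "B \<subseteq> aff (B - {x})" using subset_aff[of "B - {x}"] by blast
  then have "aff (B - {x}) = aff B" by (intro aff_eq_if_between) auto
  then have "affine_dim (B - {x}) = affine_dim B" by (simp add: affine_dim_def)
  moreover have "B - {x} \<noteq> {}" using x(2) by (metis aff_empty empty_iff)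
  then have "affine_dim (B - {x}) < card (B - {x})"
    using affine_dim_less_card assms(1) by blast
  ultimately show False using assms x(1) by simp
qed

text \<open>Moving one element of a nonempty \<open>U\<close> to the other side writes it as a sum
  of an odd number of the others.\<close>

lemma even_zero_sum_subset_affine_indep:
  fixes B :: "(bit ^ 'n) set"
  assumes "affine_indep B" "U \<subseteq> B" "finite U" "even (card U)" "\<Sum>U = 0"
  shows "U = {}"
proof (rule ccontr)
  assume "U \<noteq> {}"
  then obtain x where x: "x \<in> U" by blast
  have "x + \<Sum>(U - {x}) = 0" using assms(3,5) x by (simp add: sum.remove)
  then have "\<Sum>(U - {x}) = x" by (simp add: bit_vec_add_eq_0_iff)
  moreover have "U - {x} \<subseteq> B - {x}" using assms(2) by blast
  moreover have "card U \<noteq> 0" using x assms(3) by auto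
  then have "odd (card (U - {x}))" using assms(3,4) x by simp
  ultimately have "x \<in> aff (B - {x})" by (intro affI)
  then show False using assms(1,2) x unfolding affine_indep_def by blast
qed

text \<open>The symmetric difference of two odd representations is even with sum 0, hence
  empty.\<close>

lemma basis_rep_eqI:
  fixes B :: "(bit ^ 'n) set"
  assumes "affine_indep B" "T \<subseteq> B" "odd (card T)" "\<Sum>T = x"
  shows "basis_rep B x = T"
  unfolding basis_rep_def
proof (rule the_equality)
  fix T' assume T': "T' \<subseteq> B \<and> odd (card T') \<and> \<Sum>T' = x"
  have fin: "finite T" "finite T'" using assms T' by (auto intro: finite_if_odd_card)
  have "sym_diff T T' = {}"
    using assms T' fin
    by (intro even_zero_sum_subset_affine_indep[OF assms(1)])
      (auto simp: even_card_sym_diff sum_sym_diff_bit_vec)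
  then show "T' = T" by blast
qed (use assms in auto)

section \<open>Dependencies of a cap\<close>

text \<open>Affine relations over \<open>bit\<close> have coefficients 0 and 1, so \<open>T\<close>
  is the support; evenness says that the coefficients sum to 0. Infinite sets would qualify by the
  default values of \<open>card\<close> and sum, so later lemmas take \<open>S\<close>
  finite.\<close>

definition dependency :: "(bit ^ 'n) set \<Rightarrow> (bit ^ 'n) set \<Rightarrow> bool" where
  "dependency S T \<longleftrightarrow> T \<subseteq> S \<and> even (card T) \<and> \<Sum>T = 0"

lemma dependency_sym_diff:
  assumes "finite S" "dependency S T" "dependency S U"
  shows "dependency S (sym_diff T U)"
proof -
  have "finite T" "finite U" using assms by (auto simp: dependency_def intro: finite_subset)
  then show ?thesis
    using assms by (auto simp: dependency_def even_card_sym_diff sum_sym_diff_bit_vec)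
qed

text \<open>Two points with sum 0 coincide, and four distinct ones form a quad, so 6 is the first
  possible nonzero even size.\<close>

lemma card_dependency_of_cap:
  fixes S :: "(bit ^ 'n) set"
  assumes "finite S" "cap S" "dependency S T" "T \<noteq> {}"
  shows "card T \<ge> 6"
proof -
  have fin: "finite T" using assms by (auto simp: dependency_def intro: finite_subset)
  have "card T \<noteq> 0" using fin assms(4) by simp
  moreover have "card T \<noteq> 2"
  proof
    assume "card T = 2"
    then obtain x y where "T = {x, y}" "x \<noteq> y" by (auto simp: card_2_iff)
    then show False using assms(3) by (auto simp: dependency_def bit_vec_add_eq_0_iff)
  qed
  moreover have "card T \<noteq> 4"
    using assms(2,3) by (auto simp: cap_def quad_def dependency_def)
  moreover have "even (card T)" using assms(3) by (simp add: dependency_def)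
  ultimately show ?thesis by presburger
qed

section \<open>Weights and Venn regions of three code words\<close>

text \<open>At most one of the seven words is heavier than 6. If it is a generator, adding another
  generator replaces it by a word of weight 6. Nonempty inner regions then supply the private points
  \<open>p\<close>, \<open>q\<close>, \<open>r\<close>.\<close>

lemma even_weight_code_11_3_6:
  assumes "finite S" "card S = 11" "P \<subseteq> S" "Q \<subseteq> S" "R \<subseteq> S"
    and "\<And>T. T \<in> {P, Q, R, sym_diff P Q, sym_diff P R, sym_diff Q R, sym_diff (sym_diff P Q) R}
      \<Longrightarrow> even (card T) \<and> card T \<ge> 6"
  obtains P' Q' R' p q r
  where "P' \<in> {P, sym_diff P Q}" "Q' \<in> {Q, sym_diff P Q}" "R' \<in> {R, sym_diff P R}"
    and "card P' = 6" "card Q' = 6" "card R' = 6"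
    and "p \<in> P'" "p \<notin> Q'" "p \<notin> R'" "q \<notin> P'" "q \<in> Q'" "q \<notin> R'" "r \<notin> P'" "r \<notin> Q'" "r \<in> R'"
proof -
  \<comment> \<open>The eight region sizes are the unknowns of a linear system; the indices record
    membership in \<open>P\<close>, \<open>Q\<close>, \<open>R\<close>.\<close>
  define v where "v i j k = card {x \<in> S. (x \<in> P) = i \<and> (x \<in> Q) = j \<and> (x \<in> R) = k}" for i j k
  have split: "card {x \<in> S. \<psi> x} = (\<Sum>i\<in>UNIV. card {x \<in> S. \<psi> x \<and> (x \<in> X) = i})"
    for \<psi> and X :: "'a set"
  proof -
    have "{x \<in> S. \<psi> x} = {x \<in> S. \<psi> x \<and> x \<in> X} \<union> {x \<in> S. \<psi> x \<and> x \<notin> X}" by blast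
    also have "card \<dots> = card {x \<in> S. \<psi> x \<and> x \<in> X} + card {x \<in> S. \<psi> x \<and> x \<notin> X}"
      using assms(1) by (intro card_Un_disjoint) auto
    finally show ?thesis by (simp add: UNIV_bool)
  qed
  have region: "card {x \<in> S. \<phi> (x \<in> P) (x \<in> Q) (x \<in> R) \<and> (x \<in> P) = i \<and> (x \<in> Q) = j \<and> (x \<in> R) = k}
      = (if \<phi> i j k then v i j k else 0)" for \<phi> i j k
  proof (cases "\<phi> i j k")
    case True
    then show ?thesis unfolding v_def by (auto intro!: arg_cong[where f = card])
  next
    case False
    then have "{x \<in> S. \<phi> (x \<in> P) (x \<in> Q) (x \<in> R) \<and> (x \<in> P) = i \<and> (x \<in> Q) = j \<and> (x \<in> R) = k} = {}"
      by blast
    then show ?thesis using False by (simp only: card.empty if_False)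
  qed
  have count: "card T = (\<Sum>i\<in>UNIV. \<Sum>j\<in>UNIV. \<Sum>k\<in>UNIV. if \<phi> i j k then v i j k else 0)"
    if "T = {x \<in> S. \<phi> (x \<in> P) (x \<in> Q) (x \<in> R)}" for T \<phi>
  proof -
    let ?\<psi> = "\<lambda>x. \<phi> (x \<in> P) (x \<in> Q) (x \<in> R)"
    have "card T = (\<Sum>i\<in>UNIV. card {x \<in> S. ?\<psi> x \<and> (x \<in> P) = i})"
      unfolding that by (rule split)
    also have "\<dots> = (\<Sum>i\<in>UNIV. \<Sum>j\<in>UNIV. card {x \<in> S. (?\<psi> x \<and> (x \<in> P) = i) \<and> (x \<in> Q) = j})"
      by (intro sum.cong refl split)
    also have "\<dots> = (\<Sum>i\<in>UNIV. \<Sum>j\<in>UNIV. \<Sum>k\<in>UNIV.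
        card {x \<in> S. ((?\<psi> x \<and> (x \<in> P) = i) \<and> (x \<in> Q) = j) \<and> (x \<in> R) = k})"
      by (intro sum.cong refl split)
    finally show ?thesis by (simp only: conj_assoc region)
  qed
  have
    S: "card S = (\<Sum>i\<in>UNIV. \<Sum>j\<in>UNIV. \<Sum>k\<in>UNIV. if True then v i j k else 0)" and
    P: "card P = (\<Sum>i\<in>UNIV. \<Sum>j\<in>UNIV. \<Sum>k\<in>UNIV. if i then v i j k else 0)" and
    Q: "card Q = (\<Sum>i\<in>UNIV. \<Sum>j\<in>UNIV. \<Sum>k\<in>UNIV. if j then v i j k else 0)" and
    R: "card R = (\<Sum>i\<in>UNIV. \<Sum>j\<in>UNIV. \<Sum>k\<in>UNIV. if k then v i j k else 0)" and
    PQ: "card (sym_diff P Q) = (\<Sum>i\<in>UNIV. \<Sum>j\<in>UNIV. \<Sum>k\<in>UNIV. if i \<noteq> j then v i j k else 0)" and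
    PR: "card (sym_diff P R) = (\<Sum>i\<in>UNIV. \<Sum>j\<in>UNIV. \<Sum>k\<in>UNIV. if i \<noteq> k then v i j k else 0)" and
    QR: "card (sym_diff Q R) = (\<Sum>i\<in>UNIV. \<Sum>j\<in>UNIV. \<Sum>k\<in>UNIV. if j \<noteq> k then v i j k else 0)" and
    PQR: "card (sym_diff (sym_diff P Q) R)
      = (\<Sum>i\<in>UNIV. \<Sum>j\<in>UNIV. \<Sum>k\<in>UNIV. if (i \<noteq> j) \<noteq> k then v i j k else 0)"
    using assms(3-5) by (intro count; blast)+
  note cards = S[unfolded assms(2)] P Q R PQ PR QR PQR
  let ?W = "{P, Q, R, sym_diff P Q, sym_diff P R, sym_diff Q R, sym_diff (sym_diff P Q) R}"
  \<comment> \<open>Half weights encode evenness as a linear equation over the naturals, usable by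
    linear arithmetic.\<close>
  obtain w where w: "card T = 2 * w T" "w T \<ge> 3" if "T \<in> ?W" for T
  proof
    fix T assume "T \<in> ?W"
    with assms(6)[OF this] show "card T = 2 * (card T div 2)" "card T div 2 \<ge> 3" by auto
  qed
  note ws = w[of P, simplified] w[of Q, simplified] w[of R, simplified] w[of "sym_diff P Q", simplified]
    w[of "sym_diff P R", simplified] w[of "sym_diff Q R", simplified]
    w[of "sym_diff (sym_diff P Q) R", simplified]
  note eqs = cards[simplified UNIV_bool, simplified]
  \<comment> \<open>A point in at least one generator lies in exactly four of the seven words; this
    is that count, halved. As seven half weights give at least 21, the outer region is empty and
    exactly one half weight is 4.\<close>
  have total: "w P + w Q + w R + w (sym_diff P Q) + w (sym_diff P R) + w (sym_diff Q R)
      + w (sym_diff (sym_diff P Q) R) + 2 * v False False False = 22"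
    using eqs ws by linarith
  \<comment> \<open>The four words containing a given inner region each split the rest evenly in
    total: every other inner region lies in exactly two of them. So their half weights add up to the
    region size plus 11 minus the outer size. Being at least 12, this sum forces the region to be
    nonempty.\<close>
  have inner:
    "w P + w (sym_diff P Q) + w (sym_diff P R) + w (sym_diff (sym_diff P Q) R) + v False False False = v True False False + 11"
    "w Q + w (sym_diff P Q) + w (sym_diff Q R) + w (sym_diff (sym_diff P Q) R) + v False False False = v False True False + 11"
    "w R + w (sym_diff P R) + w (sym_diff Q R) + w (sym_diff (sym_diff P Q) R) + v False False False = v False False True + 11"
    "w P + w Q + w (sym_diff P R) + w (sym_diff Q R) + v False False False = v True True False + 11"
    "w P + w R + w (sym_diff P Q) + w (sym_diff Q R) + v False False False = v True False True + 11"
    "w Q + w R + w (sym_diff P Q) + w (sym_diff P R) + v False False False = v False True True + 11"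
    "w P + w Q + w R + w (sym_diff (sym_diff P Q) R) + v False False False = v True True True + 11"
    using eqs ws(1,3,5,7,9,11,13) by linarith+
  have pos: "v i j k > 0" if "i \<or> j \<or> k" for i j k
  proof -
    have "v True False False > 0" "v False True False > 0" "v False False True > 0" "v True True False > 0"
      "v True False True > 0" "v False True True > 0" "v True True True > 0"
      using inner ws(2,4,6,8,10,12,14) by linarith+
    then show ?thesis using that by (cases i; cases j; cases k) simp_all
  qed
  have "\<exists>x. (x \<in> P) = i \<and> (x \<in> Q) = j \<and> (x \<in> R) = k" if "i \<or> j \<or> k" for i j k
    using pos[OF that] unfolding v_def card_gt_0_iff by blast
  \<comment> \<open>\<open>e i j k\<close> picks a point of the region with that pattern; in each
    case below the patterns are those private to the chosen words.\<close>
  then obtain e where e: "(e i j k \<in> P) = i" "(e i j k \<in> Q) = j" "(e i j k \<in> R) = k"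
    if "i \<or> j \<or> k" for i j k
    by metis
  consider "card P = 6" "card Q = 6" "card R = 6" | "card (sym_diff P Q) = 6" "card Q = 6" "card R = 6"
    | "card P = 6" "card (sym_diff P Q) = 6" "card R = 6"
    | "card P = 6" "card Q = 6" "card (sym_diff P R) = 6"
  proof -
    have "w P = 3 \<and> w Q = 3 \<and> w R = 3 \<or> w (sym_diff P Q) = 3 \<and> w Q = 3 \<and> w R = 3
        \<or> w P = 3 \<and> w (sym_diff P Q) = 3 \<and> w R = 3 \<or> w P = 3 \<and> w Q = 3 \<and> w (sym_diff P R) = 3"
      using total ws(2,4,6,8,10,12,14) by linarith
    then show ?thesis using ws(1,3,5,7,9) that by auto
  qed
  then show thesis
  proof cases
    case 1
    then show thesis
      by (intro that[of P Q R "e True False False" "e False True False" "e False False True"])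
        (auto simp: e)
  next
    case 2
    then show thesis
      by (intro that[of "sym_diff P Q" Q R "e True False False" "e True True False" "e False False True"])
        (auto simp: e)
  next
    case 3
    then show thesis
      by (intro that[of P "sym_diff P Q" R "e True True False" "e False True False" "e False False True"])
        (auto simp: e)
  next
    case 4
    then show thesis
      by (intro that[of P Q "sym_diff P R" "e True False True" "e False True False" "e False False True"])
        (auto simp: e)
  qed
qed

section \<open>From private points to the basis\<close>

theorem theorem6p2:
  fixes S :: "(bit ^ 'n) set"
  assumes "k_cap 11 S"
    and "affine_dim S = 7"
  shows "\<exists>B. affine_basis B S \<and> basis_type S B = [5, 5, 5]"
proof -
  have S: "cap S" "finite S" "card S = 11" using assms(1) by (auto simp: k_cap_def)
  \<comment> \<open>The size is 8 = 7 + 1, which leaves three points outside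
    \<open>A\<close>.\<close>
  then obtain A where A: "A \<subseteq> S" "card A = 8" "S \<subseteq> aff A"
    using affine_spanning_subset_exists[of S] assms(2) by force
  have finA: "finite A" using A S finite_subset by blast
  have "card (S - A) = 3" using A S finA by (simp add: card_Diff_subset)
  then obtain a b c where abc: "S - A = {a, b, c}" "a \<noteq> b" "b \<noteq> c" "a \<noteq> c"
    by (auto simp: card_3_iff)
  \<comment> \<open>Adding \<open>x\<close> to an odd subset of \<open>A\<close> with sum
    \<open>x\<close> gives an even set with sum 0.\<close>
  have "\<exists>T. dependency S (insert x T) \<and> T \<subseteq> A" if x: "x \<in> S - A" for x
  proof -
    obtain T where T: "T \<subseteq> A" "odd (card T)" "\<Sum>T = x"
      using A(3) x unfolding aff_def by blast
    moreover have "finite T" "x \<notin> T" using T x finite_if_odd_card by blast+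
    ultimately show ?thesis using x A(1) by (auto simp: dependency_def intro!: exI[of _ T])
  qed
  then obtain rep where rep: "dependency S (insert x (rep x))" "rep x \<subseteq> A" if "x \<in> S - A" for x
    by metis
  define P Q R where "P = insert a (rep a)" and "Q = insert b (rep b)" and "R = insert c (rep c)"
  have dep: "dependency S P" "dependency S Q" "dependency S R"
    using rep abc by (auto simp: P_def Q_def R_def)
  \<comment> \<open>Each of \<open>a\<close>, \<open>b\<close>, \<open>c\<close> lies in just one
    generator, so none of the seven combinations is empty and the weight bound applies to
    all.\<close>
  have priv: "a \<in> P" "a \<notin> Q" "a \<notin> R" "b \<notin> P" "b \<in> Q" "b \<notin> R" "c \<notin> P" "c \<notin> Q" "c \<in> R"
    using rep(2) abc by (auto simp: P_def Q_def R_def)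
  have weights: "even (card T) \<and> card T \<ge> 6"
    if T: "T \<in> {P, Q, R, sym_diff P Q, sym_diff P R, sym_diff Q R, sym_diff (sym_diff P Q) R}" for T
  proof -
    have "dependency S T"
      using T dep dependency_sym_diff[OF S(2)] by auto
    moreover have "T \<noteq> {}" using T priv by auto
    ultimately show ?thesis
      using card_dependency_of_cap[OF S(2,1)] by (auto simp: dependency_def)
  qed
  have sub: "P \<subseteq> S" "Q \<subseteq> S" "R \<subseteq> S" using dep by (auto simp: dependency_def)
  obtain P' Q' R' p q r
    where PQR: "P' \<in> {P, sym_diff P Q}" "Q' \<in> {Q, sym_diff P Q}" "R' \<in> {R, sym_diff P R}"
      and six: "card P' = 6" "card Q' = 6" "card R' = 6"
      and pqr: "p \<in> P'" "p \<notin> Q'" "p \<notin> R'" "q \<notin> P'" "q \<in> Q'" "q \<notin> R'" "r \<notin> P'" "r \<notin> Q'" "r \<in> R'"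
    by (rule even_weight_code_11_3_6[OF S(2,3) sub weights])
  have dep': "dependency S P'" "dependency S Q'" "dependency S R'"
    using PQR dep dependency_sym_diff[OF S(2)] by auto
  define B where "B = S - {p, q, r}"
  have pqrS: "{p, q, r} \<subseteq> S" using pqr dep' by (auto simp: dependency_def)
  have ne: "p \<noteq> q" "q \<noteq> r" "p \<noteq> r" using pqr by auto
  \<comment> \<open>A word of weight 6 meeting \<open>{p, q, r}\<close> only in \<open>x\<close>
    expresses \<open>x\<close> by its five other points, all in \<open>B\<close>.\<close>
  have repB: "T - {x} \<subseteq> B \<and> card (T - {x}) = 5 \<and> \<Sum>(T - {x}) = x"
    if "dependency S T" "card T = 6" "x \<in> T" "T \<inter> {p, q, r} \<subseteq> {x}" for T x
  proof -
    have fin: "finite T" using that(2) by (simp add: card_ge_0_finite)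
    have "x + \<Sum>(T - {x}) = 0" using that fin by (simp add: dependency_def sum.remove)
    then show ?thesis using that fin by (auto simp: dependency_def B_def bit_vec_add_eq_0_iff)
  qed
  note reps = repB[OF dep'(1) six(1), of p] repB[OF dep'(2) six(2), of q] repB[OF dep'(3) six(3), of r]
  have reps: "P' - {p} \<subseteq> B" "card (P' - {p}) = 5" "\<Sum>(P' - {p}) = p"
    "Q' - {q} \<subseteq> B" "card (Q' - {q}) = 5" "\<Sum>(Q' - {q}) = q"
    "R' - {r} \<subseteq> B" "card (R' - {r}) = 5" "\<Sum>(R' - {r}) = r"
    using reps pqr by auto
  have in_aff: "x \<in> aff B" if "T \<subseteq> B" "card T = 5" "\<Sum>T = x" for T x
    using that by (intro affI[of T]) auto
  have "S \<subseteq> aff B"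
    using in_aff[OF reps(1-3)] in_aff[OF reps(4-6)] in_aff[OF reps(7-9)] subset_aff[of B]
    by (auto simp: B_def)
  then have aff: "aff B = aff S" by (intro aff_eq_if_between) (auto simp: B_def)
  \<comment> \<open>Having 8 points in dimension 7 makes the spanning set \<open>B\<close>
    independent, so the five-point sums are the basis representations.\<close>
  have "card B = 8" using S pqrS ne by (simp add: B_def card_Diff_subset)
  moreover have "affine_dim B = 7" using aff assms(2) by (simp add: affine_dim_def)
  ultimately have indep: "affine_indep B"
    using S(2) by (intro affine_indep_if_card_le) (auto simp: B_def)
  have "card (basis_rep B x) = 5" if "T \<subseteq> B" "card T = 5" "\<Sum>T = x" for T x
    using basis_rep_eqI[OF indep, of T x] that by simp
  then have five: "card (basis_rep B p) = 5" "card (basis_rep B q) = 5" "card (basis_rep B r) = 5"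
    using reps by blast+
  have "S - B = {p, q, r}" using pqrS by (auto simp: B_def)
  then have "basis_type S B = [5, 5, 5]"
    using ne five by (simp add: basis_type_def)
  moreover have "affine_basis B S" using aff indep by (auto simp: affine_basis_def B_def)
  ultimately show ?thesis by blast
qed

end
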